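(* Let $R$ be an integral domain containing $\mathbb{Q}$ and let $\rho(t)=1+\rho_1t+\rho_2t^2+\cdots$ be a formal power series over $R$ with constant term $1$. For each $\alpha$, let $\mathcal{Q}_\alpha(t)=\mathcal{Q}_{\rho,\alpha}(t)$ be the general series associated to $\rho$, and let $D_n(\gamma)=[t^n]\rho(t)^\gamma$. Then $$\mathcal{Q}_\alpha(t)=\rho\left(t\,\mathcal{Q}_\alpha(t)^\alpha\right).$$ Moreover, for all $\alpha$ and $\beta$, \begin{align*} \mathcal{Q}_\alpha(t)^\beta &= 1+\sum_{n=1}^\infty \frac{\beta}{\alpha n+\beta}\,D_n(\alpha n+\beta)\, t^n,\\ \mathcal{Q}_\alpha(t)^\beta\left(1+\alpha t\,\frac{\mathcal{Q}_\alpha'(t)}{\mathcal{Q}_\alpha(t)}\right) &= 1+\sum_{n=1}^\infty D_n(\alpha n+\beta)\, t^n,\\ \left(\mathcal{Q}_\alpha(t)^\beta\right)^* &= \mathcal{Q}_{\alpha-\beta}(t)^{-\beta}. \end{align*}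
   Context: Power series are formal, with coefficients in an integral domain $R$ containing $\mathbb{Q}$; $\alpha,\beta$ are constants in $R$. For a series $1+f(t)$ with $f(0)=0$, $(1+f(t))^\gamma:=\sum_{k\ge0}\binom{\gamma}{k}f(t)^k$ with $\binom{\gamma}{k}=\gamma(\gamma-1)\cdots(\gamma-k+1)/k!$. For $\rho(t)=1+\rho_1t+\rho_2t^2+\cdots$ put $D_n(\gamma):=[t^n]\rho(t)^\gamma$; for $n\ge1$ this is a polynomial in $\gamma$ divisible by $\gamma$, so $D_n(\gamma)/\gamma$ is a polynomial in $\gamma$ and is well-defined for all $\gamma$, including $\gamma=0$; all quotients $D_n(\gamma)/\gamma$ are understood this way. The general series associated to $\rho$ is $$\mathcal{Q}_{\rho,\alpha}(t)=\mathcal{Q}_\alpha(t):=1+\sum_{n=1}^\infty\frac{D_n(\alpha n+1)}{\alpha n+1}t^n.$$ The $*$ operation on a power series $f(t)$ with invertible constant term is $f^*(t):=G(t)/t$, where $G$ is the compositional inverse of $t f(t)$. *)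

theory Defs
  imports "HOL-Computational_Algebra.Computational_Algebra"
begin

text \<open>Integral domains containing the rationals.\<close>

class rat_domain = idom +
  assumes contains_Q:
    "\<exists>\<iota> :: rat \<Rightarrow> 'a. inj \<iota> \<and> \<iota> 1 = 1 \<and>
       (\<forall>x y. \<iota> (x + y) = \<iota> x + \<iota> y) \<and> (\<forall>x y. \<iota> (x * y) = \<iota> x * \<iota> y)"
begin

lemma of_nat_image_rat:
  obtains \<iota> :: "rat \<Rightarrow> 'a"
  where "inj \<iota>" "\<iota> 1 = 1" "\<And>x y. \<iota> (x * y) = \<iota> x * \<iota> y" "\<And>m. of_nat m = \<iota> (rat_of_nat m)"
proof -
  obtain \<iota> :: "rat \<Rightarrow> 'a" where \<iota>: "inj \<iota>" "\<iota> 1 = 1"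
    "\<And>x y. \<iota> (x + y) = \<iota> x + \<iota> y" "\<And>x y. \<iota> (x * y) = \<iota> x * \<iota> y"
    using contains_Q by blast
  have "\<iota> 0 + \<iota> 0 = \<iota> 0 + 0"
    using \<iota>(3)[of 0 0] by simp
  hence "\<iota> 0 = 0"
    by (simp only: add_left_cancel)
  hence "of_nat m = \<iota> (rat_of_nat m)" for m
    by (induction m) (simp_all add: \<iota>)
  with \<iota> show ?thesis
    using that by blast
qed

subclass ring_char_0
proof
  obtain \<iota> :: "rat \<Rightarrow> 'a" where "inj \<iota>" "\<And>m. of_nat m = \<iota> (rat_of_nat m)"
    by (rule of_nat_image_rat) (rule that)
  thus "inj (of_nat :: nat \<Rightarrow> 'a)"
    by (intro injI) (metis injD of_nat_eq_iff)
qed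

end

lemma fact_dvd_1: "(fact n :: 'a :: rat_domain) dvd 1"
proof -
  obtain \<iota> :: "rat \<Rightarrow> 'a" where \<iota>: "\<iota> 1 = 1" "\<And>x y. \<iota> (x * y) = \<iota> x * \<iota> y"
    "\<And>m. of_nat m = \<iota> (rat_of_nat m)"
    by (rule of_nat_image_rat) (rule that)
  have "fact n * \<iota> (1 / fact n) = \<iota> (fact n) * \<iota> (1 / fact n)"
    using \<iota>(3)[of "fact n"] by simp
  also have "\<dots> = \<iota> (fact n * (1 / fact n))"
    by (simp only: \<iota>(2))
  also have "\<dots> = 1"
    by (simp add: \<iota>(1))
  finally show ?thesis
    by (intro dvdI[where k = "\<iota> (1 / fact n)"]) simp
qed

text \<open>
  The quotient \<open>\<gamma> (\<gamma> - 1) \<cdots> (\<gamma> - k + 1) / k!\<close>. The library's \<open>gchoose\<close> needs a division on the ring.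
\<close>

definition ring_binom :: "'a :: rat_domain \<Rightarrow> nat \<Rightarrow> 'a" where
  "ring_binom \<gamma> k = (THE c. fact k * c = (\<Prod>i<k. \<gamma> - of_nat i))"

lemma fact_mult_ring_binom: "fact k * ring_binom \<gamma> k = (\<Prod>i<k. \<gamma> - of_nat i)"
proof -
  obtain u :: 'a where "1 = fact k * u"
    using fact_dvd_1 by (rule dvdE)
  hence eq: "fact k * (u * (\<Prod>i<k. \<gamma> - of_nat i)) = (\<Prod>i<k. \<gamma> - of_nat i)"
    by (simp flip: mult.assoc)
  have "c = u * (\<Prod>i<k. \<gamma> - of_nat i)" if "fact k * c = (\<Prod>i<k. \<gamma> - of_nat i)" for c
  proof -
    have "fact k * c = fact k * (u * (\<Prod>i<k. \<gamma> - of_nat i))"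
      by (simp only: that eq)
    thus ?thesis by (simp only: mult_cancel_left fact_nonzero simp_thms)
  qed
  with eq show ?thesis
    unfolding ring_binom_def by (rule theI)
qed

text \<open>
  \<open>(1 + f)\<^sup>\<gamma> = (\<Sum>k. ring_binom \<gamma> k * f^k)\<close> with \<open>f = F - 1\<close>; meaningful for series \<open>F\<close> with
  constant term 1.
\<close>

definition fps_gpow :: "'a :: rat_domain fps \<Rightarrow> 'a \<Rightarrow> 'a fps" where
  "fps_gpow F \<gamma> = Abs_fps (ring_binom \<gamma>) oo (F - 1)"

definition gpow_coeff :: "'a :: rat_domain fps \<Rightarrow> nat \<Rightarrow> 'a \<Rightarrow> 'a" where
  "gpow_coeff \<rho> n \<gamma> = fps_gpow \<rho> \<gamma> $ n"

text \<open>
  \<open>D\<^sub>n(\<gamma>) / \<gamma>\<close>, understood as the value at \<open>\<gamma>\<close> of the polynomial \<open>q\<close> with \<open>D\<^sub>n(x) = x q(x)\<close>; in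
  particular \<open>\<gamma> = 0\<close> is allowed. It exists and is unique for \<open>n \<ge> 1\<close>, as shown below.
\<close>

definition gpow_coeff_quot :: "'a :: rat_domain fps \<Rightarrow> nat \<Rightarrow> 'a \<Rightarrow> 'a" where
  "gpow_coeff_quot \<rho> n \<gamma> = poly (THE q. \<forall>x. gpow_coeff \<rho> n x = x * poly q x) \<gamma>"

lemma gpow_coeff_quot_ex1:
  fixes \<rho> :: "'a :: rat_domain fps"
  assumes "n \<ge> 1"
  shows "\<exists>!q. \<forall>x. gpow_coeff \<rho> n x = x * poly q x"
proof -
  have "\<exists>u. (fact k :: 'a) * u = 1" for k
    using fact_dvd_1[of k, where 'a = 'a] unfolding dvd_def by metis
  then obtain u where u: "\<And>k. (fact k :: 'a) * u k = 1"
    by metis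
  have binom: "ring_binom x k = u k * (\<Prod>i<k. x - of_nat i)" for x k
  proof -
    have "ring_binom x k = (fact k * u k) * ring_binom x k"
      by (simp add: u)
    also have "\<dots> = u k * (fact k * ring_binom x k)"
      by (simp only: mult_ac)
    finally show ?thesis
      by (simp only: fact_mult_ring_binom)
  qed
  define q where "q = (\<Sum>k=1..n. smult (u k * (\<rho> - 1) ^ k $ n) (\<Prod>i=1..<k. [:- of_nat i, 1:]))"
  have "gpow_coeff \<rho> n x = x * poly q x" for x
  proof -
    have "gpow_coeff \<rho> n x = (\<Sum>k=0..n. ring_binom x k * (\<rho> - 1) ^ k $ n)"
      by (simp add: gpow_coeff_def fps_gpow_def fps_compose_nth)
    also have "\<dots> = (\<Sum>k=1..n. ring_binom x k * (\<rho> - 1) ^ k $ n)"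
      using assms by (simp add: sum.atLeast_Suc_atMost)
    also have "\<dots> = (\<Sum>k=1..n. x * (u k * (\<rho> - 1) ^ k $ n * (\<Prod>i=1..<k. x - of_nat i)))"
      by (rule sum.cong)
         (simp_all add: binom lessThan_atLeast0 prod.atLeast_Suc_lessThan mult_ac)
    also have "\<dots> = x * poly q x"
      by (simp add: q_def poly_sum poly_prod sum_distrib_left)
    finally show ?thesis .
  qed
  moreover have "q' = q''"
    if "\<forall>x. gpow_coeff \<rho> n x = x * poly q' x" "\<forall>x. gpow_coeff \<rho> n x = x * poly q'' x" for q' q''
  proof -
    have "poly ([:0, 1:] * q') = poly ([:0, 1:] * q'')"
    proof
      fix x
      have "x * poly q' x = x * poly q'' x"
        using that[THEN spec, of x] by (rule trans[OF sym])
      thus "poly ([:0, 1:] * q') x = poly ([:0, 1:] * q'') x"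
        by simp
    qed
    hence "[:0, 1:] * q' = [:0, 1:] * q''"
      by (simp only: poly_eq_poly_eq_iff)
    thus ?thesis by simp
  qed
  ultimately show ?thesis by blast
qed

definition general_series :: "'a :: rat_domain fps \<Rightarrow> 'a \<Rightarrow> 'a fps" where
  "general_series \<rho> \<alpha> =
     Abs_fps (\<lambda>n. if n = 0 then 1 else gpow_coeff_quot \<rho> n (\<alpha> * of_nat n + 1))"

text \<open>The library's \<^const>\<open>fps_inv\<close> is restricted to fields.\<close>

definition is_fps_comp_inverse :: "'a :: idom fps \<Rightarrow> 'a fps \<Rightarrow> bool" where
  "is_fps_comp_inverse F G \<longleftrightarrow> G $ 0 = 0 \<and> F oo G = fps_X \<and> G oo F = fps_X"

definition fps_comp_inverse :: "'a :: idom fps \<Rightarrow> 'a fps" where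
  "fps_comp_inverse F = (THE G. is_fps_comp_inverse F G)"

lemma fps_comp_inverse_eqI:
  assumes "F $ 0 = 0" "is_fps_comp_inverse F G"
  shows "fps_comp_inverse F = G"
  unfolding fps_comp_inverse_def
proof (rule the_equality)
  fix H assume H: "is_fps_comp_inverse F H"
  have "H oo (F oo G) = (H oo F) oo G"
    using assms by (intro fps_compose_assoc) (simp_all add: is_fps_comp_inverse_def)
  moreover have "F oo G = fps_X" "H oo F = fps_X" "G $ 0 = 0"
    using H assms by (simp_all add: is_fps_comp_inverse_def)
  ultimately show "H = G"
    by simp
qed (fact assms)

text \<open>The shift by 1 is division by \<open>t\<close>, since the compositional inverse has constant term 0.\<close>

definition fps_star :: "'a :: idom fps \<Rightarrow> 'a fps" where
  "fps_star f = fps_shift 1 (fps_comp_inverse (fps_X * f))"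

end

theory Submission
  imports Defs
begin

text \<open>
  Everything comes from one change of variable. Put \<open>A(t) = t \<rho>(t)\<^sup>-\<^sup>\<alpha>\<close> and let \<open>W\<close> be its
  compositional inverse. Composing \<open>A\<close> with \<open>W\<close> gives \<open>W = t (\<rho> \<circ> W)\<^sup>\<alpha>\<close>, so \<open>F = \<rho> \<circ> W\<close> solves the
  functional equation \<open>F = \<rho>(t F\<^sup>\<alpha>)\<close>. It remains to compute the coefficients of the powers of
  \<open>F\<close> and to see that \<open>F\<close> is the general series.

  The inverse and the coefficients both come from Lagrange's formula, which is used in the form
  of an expansion in powers of \<open>A\<close> (lemma \<open>lagrange_expansion\<close>): every series \<open>H\<close> equals
  \<open>\<Sum>n. c\<^sub>n A\<^sup>n\<close> with \<open>c\<^sub>n = [t\<^sup>n] H A' \<Phi>\<^sup>n\<^sup>+\<^sup>1\<close> and \<open>\<Phi> = \<rho>\<^sup>\<alpha>\<close>. This form has no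
  factor \<open>1 / n\<close>, so the coefficients lie in the ring itself, and with \<open>H = t\<close> it produces \<open>W\<close>. With
  \<open>H = \<rho>\<^sup>\<beta> / (\<Phi> A')\<close> the coefficients are \<open>[t\<^sup>n] \<rho>\<^sup>\<beta> \<Phi>\<^sup>n = D\<^sub>n(\<alpha> n + \<beta>)\<close>, while
  \<open>H \<circ> W = F\<^sup>\<beta> F\<^sup>-\<^sup>\<alpha> (t F\<^sup>\<alpha>)' = F\<^sup>\<beta> (1 + \<alpha> t F' / F)\<close>. This is the second expansion.

  The right-hand side multiplied by \<open>\<beta>\<close> is \<open>\<beta> F\<^sup>\<beta> + \<alpha> t (F\<^sup>\<beta>)'\<close>, and comparing coefficients gives
  \<open>(\<alpha> n + \<beta>) [t\<^sup>n] F\<^sup>\<beta> = \<beta> D\<^sub>n(\<alpha> n + \<beta>)\<close>. Both sides are polynomials in \<open>\<beta>\<close>, so \<open>\<alpha> n + \<beta>\<close> may be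
  cancelled also where it vanishes; this is the first expansion, and \<open>\<beta> = 1\<close> identifies \<open>F\<close> with
  the general series. Finally, if \<open>A\<^sub>\<alpha>\<close> and \<open>W\<^sub>\<alpha>\<close> denote the two series above, then
  \<open>t F\<^sup>\<beta> = W\<^sub>\<alpha> (\<rho> \<circ> W\<^sub>\<alpha>)\<^sup>\<beta>\<^sup>-\<^sup>\<alpha> = A\<^sub>\<alpha>\<^sub>-\<^sub>\<beta> \<circ> W\<^sub>\<alpha>\<close>, whose inverse is
  \<open>A\<^sub>\<alpha> \<circ> W\<^sub>\<alpha>\<^sub>-\<^sub>\<beta>\<close>, and that is the same expression with \<open>\<alpha> - \<beta>\<close> and \<open>-\<beta>\<close> in place of \<open>\<alpha>\<close> and \<open>\<beta>\<close>.
\<close>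

section \<open>Powers with exponents in the ring\<close>

lemma ring_binom_0 [simp]: "ring_binom \<gamma> 0 = 1"
  using fact_mult_ring_binom[of 0 \<gamma>] by simp

lemma ring_binom_Suc: "of_nat (Suc k) * ring_binom \<gamma> (Suc k) = (\<gamma> - of_nat k) * ring_binom \<gamma> k"
proof -
  have "fact k * (of_nat (Suc k) * ring_binom \<gamma> (Suc k)) = fact (Suc k) * ring_binom \<gamma> (Suc k)"
    by (simp add: mult_ac)
  also have "\<dots> = (\<Prod>i<k. \<gamma> - of_nat i) * (\<gamma> - of_nat k)"
    by (simp only: fact_mult_ring_binom prod.lessThan_Suc)
  also have "\<dots> = fact k * ((\<gamma> - of_nat k) * ring_binom \<gamma> k)"
    by (simp only: fact_mult_ring_binom[symmetric] mult_ac)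
  finally show ?thesis
    by (simp only: mult_cancel_left fact_nonzero simp_thms)
qed

text \<open>
  The binomial series is determined by its differential equation; the laws for exponents follow
  from this characterisation without any Vandermonde identity.
\<close>

lemma binomial_series_ode:
  fixes \<gamma> :: "'a :: rat_domain"
  defines "B \<equiv> Abs_fps (ring_binom \<gamma>)"
  shows "(1 + fps_X) * fps_deriv B = fps_const \<gamma> * B"
proof (rule fps_ext)
  fix n
  show "((1 + fps_X) * fps_deriv B) $ n = (fps_const \<gamma> * B) $ n"
    using ring_binom_Suc[of n \<gamma>]
    by (cases n) (simp_all add: B_def algebra_simps del: of_nat_Suc)
qed

lemma binomial_series_unique:
  fixes \<gamma> :: "'a :: rat_domain"
  assumes "Y $ 0 = 1" "(1 + fps_X) * fps_deriv Y = fps_const \<gamma> * Y"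
  shows "Y = Abs_fps (ring_binom \<gamma>)"
proof (rule fps_ext)
  fix n
  show "Y $ n = Abs_fps (ring_binom \<gamma>) $ n"
  proof (induction n)
    case (Suc n)
    have "((1 + fps_X) * fps_deriv Y) $ n = (fps_const \<gamma> * Y) $ n"
      by (simp only: assms)
    hence "of_nat (Suc n) * Y $ Suc n = (\<gamma> - of_nat n) * Y $ n"
      by (cases n) (simp_all add: algebra_simps del: of_nat_Suc)
    also have "\<dots> = of_nat (Suc n) * ring_binom \<gamma> (Suc n)"
      using Suc by (simp add: ring_binom_Suc del: of_nat_Suc)
    finally show ?case
      by (simp only: mult_cancel_left of_nat_eq_0_iff fps_nth_Abs_fps) simp
  qed (simp add: assms)
qed

lemma fps_gpow_nth_0 [simp]: "fps_gpow F \<gamma> $ 0 = 1"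
  by (simp add: fps_gpow_def)

lemma fps_gpow_add:
  assumes "F $ 0 = 1"
  shows "fps_gpow F (\<gamma> + \<delta>) = fps_gpow F \<gamma> * fps_gpow F \<delta>"
proof -
  let ?B = "\<lambda>\<gamma>. Abs_fps (ring_binom \<gamma>) :: 'a fps"
  have "(1 + fps_X) * fps_deriv (?B \<gamma> * ?B \<delta>) =
      ?B \<gamma> * ((1 + fps_X) * fps_deriv (?B \<delta>)) + ((1 + fps_X) * fps_deriv (?B \<gamma>)) * ?B \<delta>"
    by (simp add: algebra_simps)
  also have "\<dots> = fps_const (\<gamma> + \<delta>) * (?B \<gamma> * ?B \<delta>)"
    by (simp only: binomial_series_ode) (simp add: algebra_simps flip: fps_const_add)
  finally have "?B \<gamma> * ?B \<delta> = ?B (\<gamma> + \<delta>)"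
    by (intro binomial_series_unique) simp_all
  thus ?thesis
    using assms by (simp add: fps_gpow_def flip: fps_compose_mult_distrib)
qed

lemma fps_gpow_0 [simp]: "fps_gpow F 0 = 1"
proof -
  have "1 = Abs_fps (ring_binom 0 :: nat \<Rightarrow> 'a)"
    by (intro binomial_series_unique) simp_all
  thus ?thesis
    by (metis fps_gpow_def fps_compose_1)
qed

lemma fps_gpow_1:
  assumes "F $ 0 = 1"
  shows "fps_gpow F 1 = F"
proof -
  have "1 + fps_X = Abs_fps (ring_binom 1 :: nat \<Rightarrow> 'a)"
    by (intro binomial_series_unique) simp_all
  hence "fps_gpow F 1 = (1 + fps_X) oo (F - 1)"
    by (simp add: fps_gpow_def)
  thus ?thesis
    using assms by (simp add: fps_compose_add_distrib)
qed

lemma fps_gpow_minus: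
  assumes "F $ 0 = 1"
  shows "fps_gpow F (- \<gamma>) * fps_gpow F \<gamma> = 1"
  using fps_gpow_add[OF assms, of "- \<gamma>" \<gamma>] by simp

lemma fps_gpow_power:
  assumes "F $ 0 = 1"
  shows "fps_gpow F \<gamma> ^ n = fps_gpow F (\<gamma> * of_nat n)"
  by (induction n) (simp_all add: distrib_left fps_gpow_add[OF assms])

lemma fps_gpow_compose:
  assumes "F $ 0 = 1" "H $ 0 = 0"
  shows "fps_gpow F \<gamma> oo H = fps_gpow (F oo H) \<gamma>"
  using assms
  by (simp add: fps_gpow_def fps_compose_assoc[symmetric] fps_compose_sub_distrib)

lemma fps_gpow_deriv:
  assumes "F $ 0 = 1"
  shows "F * fps_deriv (fps_gpow F \<gamma>) = fps_const \<gamma> * fps_deriv F * fps_gpow F \<gamma>"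
proof -
  let ?B = "Abs_fps (ring_binom \<gamma>)"
  have f0: "(F - 1) $ 0 = 0"
    using assms by simp
  have "F * (fps_deriv ?B oo (F - 1)) = ((1 + fps_X) * fps_deriv ?B) oo (F - 1)"
    using f0 by (simp add: fps_compose_mult_distrib fps_compose_add_distrib)
  also have "\<dots> = fps_const \<gamma> * fps_gpow F \<gamma>"
    using f0 by (simp only: binomial_series_ode) (simp add: fps_compose_mult_distrib fps_gpow_def)
  finally have "F * (fps_deriv ?B oo (F - 1)) = fps_const \<gamma> * fps_gpow F \<gamma>" .
  hence "F * (fps_deriv ?B oo (F - 1)) * fps_deriv F = fps_const \<gamma> * fps_gpow F \<gamma> * fps_deriv F"
    by (simp only:)
  moreover have "fps_deriv (fps_gpow F \<gamma>) = (fps_deriv ?B oo (F - 1)) * fps_deriv F"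
    using f0 by (simp add: fps_gpow_def fps_compose_deriv)
  ultimately show ?thesis
    by (simp only: mult_ac)
qed

section \<open>Lagrange's expansion and compositional inverses\<close>

text \<open>
  This is the vanishing of the residue of \<open>A' A\<^sup>-\<^sup>n\<^sup>-\<^sup>1\<close> for \<open>n > 0\<close>, stated without negative powers:
  \<open>n A' \<Phi>\<^sup>n\<^sup>+\<^sup>1 = n \<Phi>\<^sup>n - t (\<Phi>\<^sup>n)'\<close>, and both terms have the same coefficient at \<open>t\<^sup>n\<close>.
\<close>

lemma lagrange_residue:
  fixes \<Phi> \<Psi> :: "'a :: {idom, ring_char_0} fps"
  assumes inv: "\<Psi> * \<Phi> = 1"
  shows "(fps_deriv (fps_X * \<Psi>) * \<Phi> ^ Suc n) $ n = (if n = 0 then 1 else 0)"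
proof (cases n)
  case 0
  have "(\<Psi> * \<Phi>) $ 0 = 1"
    by (simp add: inv)
  thus ?thesis
    using 0 by simp
next
  case (Suc j)
  have "fps_deriv (\<Psi> * \<Phi>) = 0"
    by (simp add: inv)
  hence d: "fps_deriv \<Psi> * \<Phi> = - (\<Psi> * fps_deriv \<Phi>)"
    by (simp add: eq_neg_iff_add_eq_0 add.commute)
  have "fps_deriv (fps_X * \<Psi>) * \<Phi> ^ Suc n =
      (\<Psi> * \<Phi>) * \<Phi> ^ n + fps_X * (fps_deriv \<Psi> * \<Phi>) * \<Phi> ^ n"
    by (simp add: algebra_simps)
  also have "\<dots> = 1 * \<Phi> ^ n + fps_X * (- (\<Psi> * fps_deriv \<Phi>)) * \<Phi> ^ n"
    by (simp only: d inv)
  also have "\<dots> = \<Phi> ^ n - fps_X * (\<Psi> * \<Phi>) * (fps_deriv \<Phi> * \<Phi> ^ j)"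
    by (simp add: Suc algebra_simps)
  finally have "fps_deriv (fps_X * \<Psi>) * \<Phi> ^ Suc n = \<Phi> ^ n - fps_X * (fps_deriv \<Phi> * \<Phi> ^ j)"
    by (simp add: inv)
  hence "of_nat n * (fps_deriv (fps_X * \<Psi>) * \<Phi> ^ Suc n) =
      of_nat n * (\<Phi> ^ n - fps_X * (fps_deriv \<Phi> * \<Phi> ^ j))"
    by (simp only:)
  also have "\<dots> = of_nat n * \<Phi> ^ n - fps_X * fps_deriv (\<Phi> ^ n)"
    by (simp add: fps_deriv_power' Suc algebra_simps del: power_Suc)
  finally have "(of_nat n * (fps_deriv (fps_X * \<Psi>) * \<Phi> ^ Suc n)) $ n =
      (of_nat n * \<Phi> ^ n - fps_X * fps_deriv (\<Phi> ^ n)) $ n"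
    by (simp only:)
  hence "of_nat n * (fps_deriv (fps_X * \<Psi>) * \<Phi> ^ Suc n) $ n = 0"
    unfolding fps_sub_nth fps_mult_fps_X_deriv_shift
    by (simp del: power_Suc fps_deriv_mult)
  thus ?thesis
    using Suc by (simp only: mult_eq_0_iff of_nat_eq_0_iff) simp
qed

text \<open>
  For \<open>A = t \<Psi>\<close> and \<open>\<Phi> = 1 / \<Psi>\<close> the entry at \<open>n\<close> is the residue of \<open>H A' A\<^sup>-\<^sup>n\<^sup>-\<^sup>1\<close>, the
  coefficient that belongs to \<open>A\<^sup>n\<close> when \<open>H\<close> is expanded in powers of \<open>A\<close>.
\<close>

definition lagrange_coeffs :: "'a :: idom fps \<Rightarrow> 'a fps \<Rightarrow> 'a fps \<Rightarrow> 'a fps" where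
  "lagrange_coeffs \<Phi> \<Psi> H = Abs_fps (\<lambda>n. (H * fps_deriv (fps_X * \<Psi>) * \<Phi> ^ Suc n) $ n)"

text \<open>
  The coefficients follow the algorithm that computes an expansion in powers of \<open>A = t \<Psi>\<close>:
  split off the constant term of \<open>H\<close>, divide by \<open>A\<close>, and continue with the quotient
  \<open>((H - H(0)) / t) \<Phi>\<close>.
\<close>

lemma lagrange_coeffs_rec:
  fixes \<Phi> \<Psi> H :: "'a :: {idom, ring_char_0} fps"
  assumes inv: "\<Psi> * \<Phi> = 1"
  shows "lagrange_coeffs \<Phi> \<Psi> H =
    fps_const (H $ 0) + fps_X * lagrange_coeffs \<Phi> \<Psi> (fps_shift 1 H * \<Phi>)"
proof (rule fps_ext)
  fix n
  let ?D = "fps_deriv (fps_X * \<Psi>)"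
  have "H = fps_const (H $ 0) + fps_X * fps_shift 1 H"
    by (rule fps_ext) simp
  hence "H * ?D * \<Phi> ^ Suc n = (fps_const (H $ 0) + fps_X * fps_shift 1 H) * ?D * \<Phi> ^ Suc n"
    by (simp only:)
  hence "H * ?D * \<Phi> ^ Suc n =
      fps_const (H $ 0) * (?D * \<Phi> ^ Suc n) + fps_X * (fps_shift 1 H * \<Phi> * ?D * \<Phi> ^ n)"
    by (simp only: ring_distribs power_Suc mult_ac)
  hence "(H * ?D * \<Phi> ^ Suc n) $ n =
      (fps_const (H $ 0) * (?D * \<Phi> ^ Suc n) + fps_X * (fps_shift 1 H * \<Phi> * ?D * \<Phi> ^ n)) $ n"
    by (rule arg_cong)
  also have "\<dots> = H $ 0 * (if n = 0 then 1 else 0) + 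
      (if n = 0 then 0 else (fps_shift 1 H * \<Phi> * ?D * \<Phi> ^ n) $ (n - 1))"
    by (simp only: fps_add_nth fps_mult_left_const_nth lagrange_residue[OF inv] fps_X_mult_nth)
  finally show "lagrange_coeffs \<Phi> \<Psi> H $ n =
      (fps_const (H $ 0) + fps_X * lagrange_coeffs \<Phi> \<Psi> (fps_shift 1 H * \<Phi>)) $ n"
    by (cases n) (simp_all add: lagrange_coeffs_def del: power_Suc fps_deriv_mult)
qed

lemma lagrange_expansion:
  fixes \<Phi> \<Psi> H :: "'a :: {idom, ring_char_0} fps"
  assumes inv: "\<Psi> * \<Phi> = 1"
  shows "lagrange_coeffs \<Phi> \<Psi> H oo (fps_X * \<Psi>) = H"
proof (rule fps_ext)
  fix n
  show "(lagrange_coeffs \<Phi> \<Psi> H oo (fps_X * \<Psi>)) $ n = H $ n"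
  proof (induction n arbitrary: H rule: less_induct)
    case (less n)
    let ?K = "fps_shift 1 H * \<Phi>"
    let ?c = "\<lambda>H. lagrange_coeffs \<Phi> \<Psi> H oo (fps_X * \<Psi>)"
    have rec: "?c H = fps_const (H $ 0) + fps_X * (\<Psi> * ?c ?K)"
      by (subst lagrange_coeffs_rec[OF inv])
         (simp add: fps_compose_add_distrib fps_compose_mult_distrib mult.assoc)
    show ?case
    proof (cases n)
      case 0
      thus ?thesis by (simp add: rec)
    next
      case (Suc m)
      have "?c H $ n = (\<Psi> * ?c ?K) $ m"
        by (simp add: rec Suc)
      also have "\<dots> = (\<Psi> * ?K) $ m"
        unfolding fps_mult_nth[of \<Psi>] by (intro sum.cong) (simp_all add: less.IH Suc)
      also have "\<Psi> * ?K = (\<Psi> * \<Phi>) * fps_shift 1 H"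
        by (simp only: mult_ac)
      finally show ?thesis
        by (simp add: inv Suc)
    qed
  qed
qed

text \<open>
  The expansion of \<open>t\<close> gives a left inverse. That inverse has itself a left inverse, which must
  coincide with the original series because composition is associative.
\<close>

lemma fps_comp_inverse_exists:
  fixes \<Phi> \<Psi> :: "'a :: {idom, ring_char_0} fps"
  assumes inv: "\<Psi> * \<Phi> = 1" and "\<Psi> $ 0 = 1"
  obtains W where "is_fps_comp_inverse (fps_X * \<Psi>) W"
proof -
  define W where "W = lagrange_coeffs \<Phi> \<Psi> fps_X"
  have WA: "W oo (fps_X * \<Psi>) = fps_X"
    unfolding W_def by (rule lagrange_expansion[OF inv])
  have "(W oo (fps_X * \<Psi>)) $ 0 = 0"
    by (simp add: WA)
  hence W0: "W $ 0 = 0"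
    by simp
  define \<Omega> where "\<Omega> = fps_shift 1 W"
  have W: "W = fps_X * \<Omega>"
    by (rule fps_ext) (simp add: \<Omega>_def W0)
  have "fps_X * (\<Psi> * (\<Omega> oo (fps_X * \<Psi>))) = fps_X * 1"
    using WA by (simp add: W fps_compose_mult_distrib mult.assoc)
  hence "\<Psi> * (\<Omega> oo (fps_X * \<Psi>)) = 1"
    by (simp only: mult_cancel_left fps_X_neq_zero simp_thms)
  hence "(\<Psi> * (\<Omega> oo (fps_X * \<Psi>))) $ 0 = 1"
    by simp
  hence "\<Omega> $ 0 * 1 = 1"
    using assms by simp
  hence "fps_right_inverse \<Omega> 1 * \<Omega> = 1" "\<Omega> * fps_right_inverse \<Omega> 1 = 1"
    using fps_right_inverse[of \<Omega> 1] by (simp_all add: mult.commute)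
  then obtain V where V: "V oo W = fps_X"
    unfolding W using lagrange_expansion by blast
  have "V oo (W oo (fps_X * \<Psi>)) = V oo W oo (fps_X * \<Psi>)"
    by (rule fps_compose_assoc) (simp_all add: W0)
  hence "V = fps_X * \<Psi>"
    by (simp add: WA V)
  with V WA W0 show ?thesis
    by (intro that[of W]) (simp add: is_fps_comp_inverse_def)
qed

section \<open>The solution of the functional equation\<close>

text \<open>
  The solution is \<open>\<rho> \<circ> W\<close> for the compositional inverse \<open>W\<close> of \<open>t \<rho>\<^sup>-\<^sup>\<alpha>\<close>. That \<open>t F\<^sup>\<alpha>\<close> equals
  \<open>W\<close> is recorded too, since the coefficients of the powers of \<open>F\<close> come from expansions in powers
  of \<open>t \<rho>\<^sup>-\<^sup>\<alpha>\<close>.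
\<close>

lemma functional_equation_solution:
  fixes \<rho> :: "'a :: rat_domain fps"
  assumes \<rho>: "\<rho> $ 0 = 1"
  obtains F where "F = \<rho> oo (fps_X * fps_gpow F \<alpha>)"
    "is_fps_comp_inverse (fps_X * fps_gpow \<rho> (- \<alpha>)) (fps_X * fps_gpow F \<alpha>)"
proof -
  obtain W where W: "is_fps_comp_inverse (fps_X * fps_gpow \<rho> (- \<alpha>)) W"
    by (rule fps_comp_inverse_exists[OF fps_gpow_minus[OF \<rho>] fps_gpow_nth_0])
  hence W0: "W $ 0 = 0" and AW: "(fps_X * fps_gpow \<rho> (- \<alpha>)) oo W = fps_X"
    by (simp_all add: is_fps_comp_inverse_def)
  define F where "F = \<rho> oo W"
  have F0: "F $ 0 = 1"
    by (simp add: F_def \<rho>)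
  have "W * fps_gpow F (- \<alpha>) = fps_X"
    using AW by (simp add: fps_compose_mult_distrib fps_gpow_compose W0 \<rho> F_def)
  hence "W * (fps_gpow F (- \<alpha>) * fps_gpow F \<alpha>) = fps_X * fps_gpow F \<alpha>"
    by (simp flip: mult.assoc)
  hence W_eq: "W = fps_X * fps_gpow F \<alpha>"
    by (simp add: fps_gpow_minus F0)
  show ?thesis
    using F_def W unfolding W_eq by (rule that)
qed

context
  fixes \<rho> F :: "'a :: rat_domain fps" and \<alpha> :: 'a
  assumes \<rho>0: "\<rho> $ 0 = 1"
    and F_eq: "F = \<rho> oo (fps_X * fps_gpow F \<alpha>)"
    and F_inv: "is_fps_comp_inverse (fps_X * fps_gpow \<rho> (- \<alpha>)) (fps_X * fps_gpow F \<alpha>)"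
begin

lemma solution_nth_0: "F $ 0 = 1"
  by (subst F_eq) (simp add: \<rho>0)

lemma gpow_compose_solution:
  "fps_gpow \<rho> \<beta> oo (fps_X * fps_gpow F \<alpha>) = fps_gpow F \<beta>"
  by (subst fps_gpow_compose) (simp_all add: \<rho>0 flip: F_eq)

text \<open>
  Lagrange's expansion of \<open>H = \<rho>\<^sup>\<beta> / (\<Phi> A')\<close>. The division by \<open>A'\<close> is multiplication by
  \<open>W' \<circ> A\<close>, as \<open>W \<circ> A = t\<close>.
\<close>

lemma gpow_coeff_series:
  "Abs_fps (\<lambda>n. gpow_coeff \<rho> n (\<alpha> * of_nat n + \<beta>)) =
     fps_gpow F \<beta> * fps_gpow F (- \<alpha>) * fps_deriv (fps_X * fps_gpow F \<alpha>)"
proof -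
  define W where "W = fps_X * fps_gpow F \<alpha>"
  define \<Phi> where "\<Phi> = fps_gpow \<rho> \<alpha>"
  define \<Psi> where "\<Psi> = fps_gpow \<rho> (- \<alpha>)"
  define A where "A = fps_X * \<Psi>"
  define H where "H = fps_gpow \<rho> \<beta> * \<Psi> * (fps_deriv W oo A)"
  have WA: "W oo A = fps_X" and AW: "A oo W = fps_X" and W0: "W $ 0 = 0" and A0: "A $ 0 = 0"
    using F_inv by (simp_all add: is_fps_comp_inverse_def W_def A_def \<Psi>_def)
  have W: "fps_gpow \<rho> \<gamma> oo W = fps_gpow F \<gamma>" for \<gamma>
    unfolding W_def by (rule gpow_compose_solution)
  have inv: "\<Psi> * \<Phi> = 1"
    unfolding \<Psi>_def \<Phi>_def by (rule fps_gpow_minus[OF \<rho>0])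
  have "fps_deriv (W oo A) = 1"
    by (simp add: WA)
  hence deriv: "(fps_deriv W oo A) * fps_deriv A = 1"
    by (simp add: fps_compose_deriv A0)
  \<comment> \<open>\<open>H\<close> is chosen so that its expansion has the coefficients \<open>[t\<^sup>n] \<rho>\<^sup>\<beta> \<Phi>\<^sup>n\<close>.\<close>
  have coeffs: "H * fps_deriv A * \<Phi> ^ Suc n = fps_gpow \<rho> (\<alpha> * of_nat n + \<beta>)" for n
  proof -
    have "H * fps_deriv A * \<Phi> ^ Suc n =
        ((fps_deriv W oo A) * fps_deriv A) * (\<Psi> * \<Phi>) * (\<Phi> ^ n * fps_gpow \<rho> \<beta>)"
      by (simp add: H_def mult_ac)
    also have "\<dots> = fps_gpow \<rho> (\<alpha> * of_nat n + \<beta>)"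
      by (simp add: deriv inv) (simp add: \<Phi>_def fps_gpow_power fps_gpow_add \<rho>0)
    finally show ?thesis .
  qed
  have "Abs_fps (\<lambda>n. gpow_coeff \<rho> n (\<alpha> * of_nat n + \<beta>)) = lagrange_coeffs \<Phi> \<Psi> H"
    unfolding lagrange_coeffs_def A_def[symmetric] coeffs gpow_coeff_def ..
  also have "\<dots> = lagrange_coeffs \<Phi> \<Psi> H oo (A oo W)"
    by (simp add: AW)
  also have "\<dots> = lagrange_coeffs \<Phi> \<Psi> H oo A oo W"
    by (rule fps_compose_assoc) (simp_all add: A0 W0)
  also have "\<dots> = H oo W"
    unfolding A_def by (simp only: lagrange_expansion[OF inv])
  also have "\<dots> = (fps_gpow \<rho> \<beta> oo W) * (\<Psi> oo W) * (fps_deriv W oo A oo W)"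
    by (simp add: H_def fps_compose_mult_distrib W0)
  also have "fps_deriv W oo A oo W = fps_deriv W oo (A oo W)"
    by (rule fps_compose_assoc[symmetric]) (simp_all add: A0 W0)
  finally show ?thesis
    unfolding W_def[symmetric] by (simp only: AW W \<Psi>_def fps_compose_fps_X)
qed

lemma gpow_coeff_series_log_deriv:
  "fps_gpow F \<beta> * (1 + fps_const \<alpha> * fps_X * (fps_deriv F * fps_right_inverse F 1)) =
     Abs_fps (\<lambda>n. gpow_coeff \<rho> n (\<alpha> * of_nat n + \<beta>))"
proof -
  define I where "I = fps_right_inverse F 1"
  have FI: "F * I = 1"
    unfolding I_def by (rule fps_right_inverse) (simp add: solution_nth_0)
  have "fps_deriv (fps_gpow F \<alpha>) = (F * fps_deriv (fps_gpow F \<alpha>)) * I"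
    using FI by (simp add: mult_ac)
  also have "\<dots> = fps_const \<alpha> * fps_deriv F * I * fps_gpow F \<alpha>"
    by (simp add: fps_gpow_deriv solution_nth_0 mult_ac)
  finally have "fps_deriv (fps_X * fps_gpow F \<alpha>) =
      fps_gpow F \<alpha> * (1 + fps_const \<alpha> * fps_X * (fps_deriv F * I))"
    by (simp add: algebra_simps)
  hence "Abs_fps (\<lambda>n. gpow_coeff \<rho> n (\<alpha> * of_nat n + \<beta>)) =
      fps_gpow F \<beta> * (fps_gpow F (- \<alpha>) * fps_gpow F \<alpha>) *
        (1 + fps_const \<alpha> * fps_X * (fps_deriv F * I))"
    by (simp add: gpow_coeff_series mult.assoc)
  thus ?thesis
    by (simp add: fps_gpow_minus solution_nth_0 I_def)
qed

lemma gpow_coeff_solution: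
  "\<beta> * gpow_coeff \<rho> n (\<alpha> * of_nat n + \<beta>) = (\<alpha> * of_nat n + \<beta>) * gpow_coeff F n \<beta>"
proof -
  define I where "I = fps_right_inverse F 1"
  define T where "T = fps_gpow F \<beta>"
  have FI: "F * I = 1"
    unfolding I_def by (rule fps_right_inverse) (simp add: solution_nth_0)
  have "fps_const \<beta> * (T * (fps_deriv F * I)) = (F * fps_deriv T) * I"
    unfolding T_def by (simp add: fps_gpow_deriv solution_nth_0 mult_ac)
  also have "\<dots> = fps_deriv T"
    using FI by (simp add: mult_ac)
  finally have T': "fps_const \<beta> * (T * (fps_deriv F * I)) = fps_deriv T" .
  have "fps_const \<beta> * (T * (1 + fps_const \<alpha> * fps_X * (fps_deriv F * I))) =
      fps_const \<beta> * T + fps_const \<alpha> * (fps_X * (fps_const \<beta> * (T * (fps_deriv F * I))))"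
    by (simp only: distrib_left mult_1_left mult_1_right mult_ac)
  also have "\<dots> = fps_const \<beta> * T + fps_const \<alpha> * (fps_X * fps_deriv T)"
    by (simp only: T')
  finally have "(fps_const \<beta> * Abs_fps (\<lambda>n. gpow_coeff \<rho> n (\<alpha> * of_nat n + \<beta>))) $ n =
      (fps_const \<beta> * T + fps_const \<alpha> * (fps_X * fps_deriv T)) $ n"
    by (simp only: T_def I_def gpow_coeff_series_log_deriv)
  thus ?thesis
    unfolding fps_mult_fps_X_deriv_shift by (simp add: T_def gpow_coeff_def algebra_simps)
qed

end

lemma gpow_coeff_quot_poly:
  assumes "n \<ge> 1"
  obtains q where "\<And>x. gpow_coeff \<rho> n x = x * poly q x" "\<And>x. gpow_coeff_quot \<rho> n x = poly q x"
proof -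
  let ?P = "\<lambda>q. \<forall>x. gpow_coeff \<rho> n x = x * poly q x"
  have "?P (The ?P)"
    by (rule theI'[OF gpow_coeff_quot_ex1[OF assms]])
  hence "gpow_coeff \<rho> n x = x * poly (The ?P) x" for x
    by (rule spec)
  thus ?thesis
    by (rule that) (rule gpow_coeff_quot_def)
qed

text \<open>
  Where \<open>\<alpha> n + \<beta> = 0\<close> the identity \<open>\<beta> D\<^sub>n(\<alpha> n + \<beta>) = (\<alpha> n + \<beta>) [t\<^sup>n] F\<^sup>\<beta>\<close> does not determine
  the coefficient of \<open>F\<^sup>\<beta>\<close>. The factor \<open>\<alpha> n + \<beta>\<close> is therefore cancelled from it as an identity
  of polynomials in \<open>\<beta>\<close>.
\<close>

lemma gpow_solution_nth:
  fixes \<rho> :: "'a :: rat_domain fps"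
  assumes "n \<ge> 1" "\<rho> $ 0 = 1" "F = \<rho> oo (fps_X * fps_gpow F \<alpha>)"
    "is_fps_comp_inverse (fps_X * fps_gpow \<rho> (- \<alpha>)) (fps_X * fps_gpow F \<alpha>)"
  shows "fps_gpow F \<beta> $ n = \<beta> * gpow_coeff_quot \<rho> n (\<alpha> * of_nat n + \<beta>)"
proof -
  let ?l = "[:\<alpha> * of_nat n, 1:]"
  obtain p where p: "\<And>x. gpow_coeff F n x = x * poly p x"
    by (rule gpow_coeff_quot_poly[OF assms(1), of F]) (rule that)
  obtain q where q: "\<And>x. gpow_coeff \<rho> n x = x * poly q x" "\<And>x. gpow_coeff_quot \<rho> n x = poly q x"
    by (rule gpow_coeff_quot_poly[OF assms(1), of \<rho>]) (rule that)
  have "poly ([:0, 1:] * (?l * pcompose q ?l)) = poly ([:0, 1:] * (?l * p))"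
  proof
    fix x
    have "x * ((\<alpha> * of_nat n + x) * poly q (\<alpha> * of_nat n + x)) =
        x * ((\<alpha> * of_nat n + x) * poly p x)"
      using gpow_coeff_solution[OF assms(2-4), of x n] by (simp only: p q mult_ac)
    thus "poly ([:0, 1:] * (?l * pcompose q ?l)) x = poly ([:0, 1:] * (?l * p)) x"
      by (simp only: poly_mult poly_pcompose poly_pCons poly_0 mult_zero_right mult_1_right add_0_left
          add_0_right)
  qed
  hence "[:0, 1:] * (?l * pcompose q ?l) = [:0, 1:] * (?l * p)"
    by (simp only: poly_eq_poly_eq_iff)
  hence "pcompose q ?l = p"
    by (simp only: mult_cancel_left) simp
  hence "poly p \<beta> = poly q (\<alpha> * of_nat n + \<beta>)"
    by (auto simp: poly_pcompose)
  thus ?thesis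
    using p[of \<beta>] by (simp add: gpow_coeff_def q)
qed

lemma general_series_eq_solution:
  fixes \<rho> :: "'a :: rat_domain fps"
  assumes "\<rho> $ 0 = 1" "F = \<rho> oo (fps_X * fps_gpow F \<alpha>)"
    "is_fps_comp_inverse (fps_X * fps_gpow \<rho> (- \<alpha>)) (fps_X * fps_gpow F \<alpha>)"
  shows "general_series \<rho> \<alpha> = F"
proof (rule fps_ext)
  fix n
  have F0: "F $ 0 = 1"
    using solution_nth_0[OF assms] .
  show "general_series \<rho> \<alpha> $ n = F $ n"
    using gpow_solution_nth[OF _ assms, of n 1]
    by (cases "n = 0") (simp_all add: general_series_def F0 fps_gpow_1)
qed

lemma general_series_solution:
  fixes \<rho> :: "'a :: rat_domain fps"
  assumes "\<rho> $ 0 = 1"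
  shows "general_series \<rho> \<alpha> = \<rho> oo (fps_X * fps_gpow (general_series \<rho> \<alpha>) \<alpha>)" (is ?eq)
    and "is_fps_comp_inverse (fps_X * fps_gpow \<rho> (- \<alpha>))
           (fps_X * fps_gpow (general_series \<rho> \<alpha>) \<alpha>)" (is ?inv)
proof -
  obtain F where F: "F = \<rho> oo (fps_X * fps_gpow F \<alpha>)"
    "is_fps_comp_inverse (fps_X * fps_gpow \<rho> (- \<alpha>)) (fps_X * fps_gpow F \<alpha>)"
    using functional_equation_solution[OF assms] .
  have eq: "general_series \<rho> \<alpha> = F"
    by (rule general_series_eq_solution[OF assms F])
  show ?eq ?inv
    unfolding eq by (fact F)+
qed

section \<open>The star operation\<close>

lemma is_fps_comp_inverse_compose:
  fixes A B :: "'a :: idom fps"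
  assumes inv: "is_fps_comp_inverse A V" "is_fps_comp_inverse B W"
    and A: "A $ 0 = 0" and B: "B $ 0 = 0"
  shows "is_fps_comp_inverse (A oo W) (B oo V)"
proof -
  have V: "V $ 0 = 0" "A oo V = fps_X" "V oo A = fps_X"
    and W: "W $ 0 = 0" "B oo W = fps_X" "W oo B = fps_X"
    using inv unfolding is_fps_comp_inverse_def by blast+
  have "A oo W oo (B oo V) = A oo W oo B oo V"
    by (rule fps_compose_assoc[OF V(1) B])
  also have "A oo W oo B = A oo (W oo B)"
    by (rule fps_compose_assoc[OF B W(1), symmetric])
  finally have 1: "A oo W oo (B oo V) = fps_X"
    by (simp only: V W fps_compose_fps_X)
  have "B oo V oo (A oo W) = B oo V oo A oo W"
    by (rule fps_compose_assoc[OF W(1) A])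
  also have "B oo V oo A = B oo (V oo A)"
    by (rule fps_compose_assoc[OF A V(1), symmetric])
  finally have 2: "B oo V oo (A oo W) = fps_X"
    by (simp only: V W fps_compose_fps_X)
  show ?thesis
    unfolding is_fps_comp_inverse_def fps_compose_nth_0 by (intro conjI B 1 2)
qed

text \<open>
  As \<open>t Q\<^sub>\<alpha>\<^sup>\<alpha>\<close> is the inverse of \<open>t \<rho>\<^sup>-\<^sup>\<alpha>\<close>, this writes every \<open>t Q\<^sub>\<alpha>\<^sup>\<beta>\<close> as a composition of
  two series with known inverses.
\<close>

lemma general_series_gpow_compose:
  fixes \<rho> :: "'a :: rat_domain fps"
  assumes "\<rho> $ 0 = 1"
  shows "(fps_X * fps_gpow \<rho> (- (\<alpha> - \<beta>))) oo (fps_X * fps_gpow (general_series \<rho> \<alpha>) \<alpha>) =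
    fps_X * fps_gpow (general_series \<rho> \<alpha>) \<beta>"
proof -
  let ?Q = "general_series \<rho> \<alpha>"
  note sol = general_series_solution[OF assms, of \<alpha>]
  have Q0: "?Q $ 0 = 1"
    using solution_nth_0[OF assms sol] .
  have "(fps_X * fps_gpow \<rho> (- (\<alpha> - \<beta>))) oo (fps_X * fps_gpow ?Q \<alpha>) =
      fps_X * (fps_gpow ?Q \<alpha> * fps_gpow ?Q (- (\<alpha> - \<beta>)))"
    by (simp add: fps_compose_mult_distrib mult.assoc
          gpow_compose_solution[OF assms sol] del: minus_diff_eq)
  thus ?thesis
    by (simp flip: fps_gpow_add[OF Q0])
qed

lemma fps_star_general_series:
  fixes \<rho> :: "'a :: rat_domain fps"
  assumes "\<rho> $ 0 = 1"
  shows "fps_star (fps_gpow (general_series \<rho> \<alpha>) \<beta>) =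
    fps_gpow (general_series \<rho> (\<alpha> - \<beta>)) (- \<beta>)"
proof -
  let ?A = "\<lambda>\<alpha>. fps_X * fps_gpow \<rho> (- \<alpha>)"
  let ?W = "\<lambda>\<alpha>. fps_X * fps_gpow (general_series \<rho> \<alpha>) \<alpha>"
  have "is_fps_comp_inverse (?A (\<alpha> - \<beta>) oo ?W \<alpha>) (?A \<alpha> oo ?W (\<alpha> - \<beta>))"
    by (rule is_fps_comp_inverse_compose[OF general_series_solution(2)[OF assms]
          general_series_solution(2)[OF assms]]) simp_all
  moreover have "?A (\<alpha> - \<beta>) oo ?W \<alpha> = fps_X * fps_gpow (general_series \<rho> \<alpha>) \<beta>"
    by (rule general_series_gpow_compose[OF assms])
  moreover have "?A \<alpha> oo ?W (\<alpha> - \<beta>) = fps_X * fps_gpow (general_series \<rho> (\<alpha> - \<beta>)) (- \<beta>)"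
    using general_series_gpow_compose[OF assms, of "\<alpha> - \<beta>" "- \<beta>"]
    by (simp only: diff_minus_eq_add diff_add_cancel)
  ultimately have "is_fps_comp_inverse (fps_X * fps_gpow (general_series \<rho> \<alpha>) \<beta>)
      (fps_X * fps_gpow (general_series \<rho> (\<alpha> - \<beta>)) (- \<beta>))"
    by (simp only:)
  hence "fps_comp_inverse (fps_X * fps_gpow (general_series \<rho> \<alpha>) \<beta>) =
      fps_X * fps_gpow (general_series \<rho> (\<alpha> - \<beta>)) (- \<beta>)"
    by (intro fps_comp_inverse_eqI) simp_all
  thus ?thesis
    by (simp only: fps_star_def) (rule fps_ext, simp)
qed

section \<open>The expansions of the general series\<close>

theorem theorem8p2:
  fixes \<rho> :: "'a :: rat_domain fps"
  assumes "\<rho> $ 0 = 1"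
  shows "(\<forall>\<alpha>. general_series \<rho> \<alpha> = \<rho> oo (fps_X * fps_gpow (general_series \<rho> \<alpha>) \<alpha>)) \<and>
    (\<forall>\<alpha> \<beta>.
      fps_gpow (general_series \<rho> \<alpha>) \<beta> =
        Abs_fps (\<lambda>n. if n = 0 then 1 else \<beta> * gpow_coeff_quot \<rho> n (\<alpha> * of_nat n + \<beta>)) \<and>
      fps_gpow (general_series \<rho> \<alpha>) \<beta> *
          (1 + fps_const \<alpha> * fps_X *
            (fps_deriv (general_series \<rho> \<alpha>) * fps_right_inverse (general_series \<rho> \<alpha>) 1)) =
        Abs_fps (\<lambda>n. if n = 0 then 1 else gpow_coeff \<rho> n (\<alpha> * of_nat n + \<beta>)) \<and>
      fps_star (fps_gpow (general_series \<rho> \<alpha>) \<beta>) =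
        fps_gpow (general_series \<rho> (\<alpha> - \<beta>)) (- \<beta>))"
proof (intro conjI allI)
  fix \<alpha> \<beta> :: 'a
  let ?Q = "general_series \<rho> \<alpha>"
  note sol = general_series_solution[OF assms, of \<alpha>]
  show "?Q = \<rho> oo (fps_X * fps_gpow ?Q \<alpha>)"
    by (rule sol)
  show "fps_gpow ?Q \<beta> =
      Abs_fps (\<lambda>n. if n = 0 then 1 else \<beta> * gpow_coeff_quot \<rho> n (\<alpha> * of_nat n + \<beta>))"
    by (rule fps_ext) (simp add: gpow_solution_nth[OF _ assms sol])
  have "gpow_coeff \<rho> 0 \<gamma> = 1" for \<gamma>
    by (simp add: gpow_coeff_def)
  thus "fps_gpow ?Q \<beta> *
      (1 + fps_const \<alpha> * fps_X * (fps_deriv ?Q * fps_right_inverse ?Q 1)) =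
      Abs_fps (\<lambda>n. if n = 0 then 1 else gpow_coeff \<rho> n (\<alpha> * of_nat n + \<beta>))"
    unfolding gpow_coeff_series_log_deriv[OF assms sol] by (intro fps_ext) simp
  show "fps_star (fps_gpow ?Q \<beta>) = fps_gpow (general_series \<rho> (\<alpha> - \<beta>)) (- \<beta>)"
    by (rule fps_star_general_series[OF assms])
qed

end
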